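(* Let $M\ge1$ be an integer, let $\mathcal{S}$ be a finite set and $\mathcal{E}\subseteq\mathcal{S}\times\mathcal{S}\times\{1,\dots,M\}$. Let $\{A_i\}_{i=1}^M\subseteq\mathbb{R}^{n\times n}$, $\{B_i\}_{i=1}^M\subseteq\mathbb{R}^{n\times m}$, $\{K_\alpha\}_{\alpha\in\mathcal{S}}\subseteq\mathbb{R}^{m\times n}$, let $P_\alpha\in\mathbb{R}^{n\times n}$ be symmetric positive definite for each $\alpha\in\mathcal{S}$, and let $Q\in\mathbb{R}^{n\times n}$ and $R\in\mathbb{R}^{m\times m}$ be symmetric positive definite. Set $S_\alpha=P_\alpha^{-1}$ and $Y_\alpha=K_\alpha P_\alpha^{-1}$ for all $\alpha\in\mathcal{S}$. Then the inequalities $$P_\alpha-Q-K_\alpha^\top RK_\alpha-A_i^\top P_\beta A_i-K_\alpha^\top B_i^\top P_\beta B_iK_\alpha-K_\alpha^\top B_i^\top P_\beta A_i-A_i^\top P_\beta B_iK_\alpha\succeq0,\qquad\forall(\alpha,\beta,i)\in\mathcal{E},$$ are equivalent to $$\begin{bmatrix} S_\alpha & S_\alpha A_i^\top+Y_\alpha^\top B_i^\top & S_\alpha & Y_\alpha^\top \\ A_i S_\alpha+B_i Y_\alpha & S_\beta & 0 & 0 \\ S_\alpha & 0 & Q^{-1} & 0 \\ Y_\alpha & 0 & 0 & R^{-1} \end{bmatrix}\succeq0,\qquad\forall(\alpha,\beta,i)\in\mathcal{E}.$$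
   Context: For a symmetric matrix $X$, $X\succeq0$ means that $X$ is positive semidefinite. *)

theory Defs
  imports "HOL-Analysis.Analysis"
begin

text \<open>Over the reals, positivity of the quadratic form does not imply symmetry, so both
  predicates include it.\<close>

definition psd_matrix :: "real ^ 'n ^ 'n \<Rightarrow> bool" where
  "psd_matrix X \<longleftrightarrow> transpose X = X \<and> (\<forall>x. 0 \<le> x \<bullet> (X *v x))"

definition pd_matrix :: "real ^ 'n ^ 'n \<Rightarrow> bool" where
  "pd_matrix X \<longleftrightarrow> transpose X = X \<and> (\<forall>x. x \<noteq> 0 \<longrightarrow> 0 < x \<bullet> (X *v x))"

text \<open>Rows are the outer index: \<open>'a ^ 'n ^ 'p\<close> is the type of \<open>p \<times> n\<close> matrices.
  Concatenation is indexed by a sum type, \<open>Inl\<close> selecting the left (upper) block.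
  \<open>|||\<close> binds tighter than \<open>///\<close>, so a block matrix is written row by row.\<close>

definition hcat :: "'a ^ 'n ^ 'p \<Rightarrow> 'a ^ 'm ^ 'p \<Rightarrow> 'a ^ ('n + 'm) ^ 'p"  (infixr \<open>|||\<close> 56) where
  "X ||| Y = (\<chi> i j. case j of Inl k \<Rightarrow> X $ i $ k | Inr l \<Rightarrow> Y $ i $ l)"

definition vcat :: "'a ^ 'n ^ 'p \<Rightarrow> 'a ^ 'n ^ 'q \<Rightarrow> 'a ^ 'n ^ ('p + 'q)"  (infixr \<open>'/'/'/\<close> 55) where
  "X /// Y = (\<chi> i. case i of Inl k \<Rightarrow> X $ k | Inr l \<Rightarrow> Y $ l)"

end

theory Submission
  imports Defs
begin

text \<open>The block matrix of the second family is \<open>[[S\<^sub>\<alpha>, C\<^sup>T], [C, D]]\<close>, where \<open>C\<close> stacks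
  \<open>A\<^sub>i S\<^sub>\<alpha> + B\<^sub>i Y\<^sub>\<alpha>\<close>, \<open>S\<^sub>\<alpha>\<close> and \<open>Y\<^sub>\<alpha>\<close>, and \<open>D\<close> is block diagonal with blocks \<open>S\<^sub>\<beta>\<close>, \<open>Q\<^sup>-\<^sup>1\<close>
  and \<open>R\<^sup>-\<^sup>1\<close>. Since \<open>D\<close> is positive definite, the block matrix is positive semidefinite exactly
  when its Schur complement \<open>S\<^sub>\<alpha> - C\<^sup>T D\<^sup>-\<^sup>1 C\<close> is (\<open>psd_matrix_Schur\<close>). As \<open>Y\<^sub>\<alpha> = K\<^sub>\<alpha> S\<^sub>\<alpha>\<close>,
  every block of \<open>C\<close> has the right factor \<open>S\<^sub>\<alpha>\<close>, and the Schur complement is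
  \<open>S\<^sub>\<alpha> (P\<^sub>\<alpha> - Q - K\<^sub>\<alpha>\<^sup>T R K\<^sub>\<alpha> - (A\<^sub>i + B\<^sub>i K\<^sub>\<alpha>)\<^sup>T P\<^sub>\<beta> (A\<^sub>i + B\<^sub>i K\<^sub>\<alpha>)) S\<^sub>\<alpha>\<close>.
  The middle factor, expanded, is the matrix of the first family, and \<open>S\<^sub>\<alpha>\<close> is symmetric and
  invertible, so congruence with it changes nothing (\<open>psd_matrix_congruence_iff\<close>). The two
  families are thus equivalent index by index.

  The Schur criterion is itself a congruence: block Gaussian elimination turns the block matrix
  into a block diagonal one.\<close>

section \<open>Algebra of block matrices\<close>

lemma transpose_hcat: "transpose (X ||| Y) = transpose X /// transpose Y"
  by (auto simp: hcat_def vcat_def transpose_def vec_eq_iff split: sum.split)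

lemma transpose_vcat: "transpose (X /// Y) = transpose X ||| transpose Y"
  by (auto simp: hcat_def vcat_def transpose_def vec_eq_iff split: sum.split)

text \<open>A block matrix written row by row is regrouped by columns; this is how the four rows of a
  \<open>4 \<times> 4\<close> block matrix are merged into a \<open>2 \<times> 2\<close> one.\<close>

lemma vcat_hcat_interchange: "(X ||| Y) /// (Z ||| W) = (X /// Z) ||| (Y /// W)"
  by (auto simp: hcat_def vcat_def vec_eq_iff split: sum.split)

lemma hcat_mult_vcat:
  fixes X :: "real ^ 'n ^ 'p" and Y :: "real ^ 'm ^ 'p"
  shows "(X ||| Y) ** (Z /// W) = X ** Z + Y ** W"
  by (simp add: hcat_def vcat_def matrix_matrix_mult_def vec_eq_iff
      UNIV_Plus_UNIV [symmetric] sum.Plus del: UNIV_Plus_UNIV)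

lemma vcat_mult:
  fixes X :: "real ^ 'n ^ 'p" and Y :: "real ^ 'n ^ 'q"
  shows "(X /// Y) ** Z = (X ** Z) /// (Y ** Z)"
  by (auto simp: vcat_def matrix_matrix_mult_def vec_eq_iff split: sum.split)

lemma mult_hcat:
  fixes X :: "real ^ 'n ^ 'p" and Y :: "real ^ 'k ^ 'n" and Z :: "real ^ 'l ^ 'n"
  shows "X ** (Y ||| Z) = X ** Y ||| X ** Z"
  by (auto simp: hcat_def matrix_matrix_mult_def vec_eq_iff split: sum.split)

lemma hcat_add:
  fixes X :: "real ^ 'n ^ 'p" and Y :: "real ^ 'm ^ 'p"
  shows "(X ||| Y) + (X' ||| Y') = (X + X') ||| (Y + Y')"
  by (auto simp: hcat_def vec_eq_iff split: sum.split)

lemma vcat_add: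
  fixes X :: "real ^ 'n ^ 'p" and Y :: "real ^ 'n ^ 'q"
  shows "(X /// Y) + (X' /// Y') = (X + X') /// (Y + Y')"
  by (auto simp: vcat_def vec_eq_iff split: sum.split)

lemma hcat_zero: "((0 :: real ^ 'n ^ 'p) ||| (0 :: real ^ 'm ^ 'p)) = 0"
  by (auto simp: hcat_def vec_eq_iff split: sum.split)

lemma vcat_zero: "((0 :: real ^ 'n ^ 'p) /// (0 :: real ^ 'n ^ 'q)) = 0"
  by (auto simp: vcat_def vec_eq_iff split: sum.split)

lemma transpose_zero: "transpose (0 :: real ^ 'n ^ 'm) = 0"
  by (simp add: transpose_def vec_eq_iff)

lemma transpose_add:
  fixes X Y :: "real ^ 'n ^ 'm"
  shows "transpose (X + Y) = transpose X + transpose Y"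
  by (simp add: transpose_def vec_eq_iff)

lemma matrix_mult_zero_left: "(0 :: real ^ 'n ^ 'm) ** (X :: real ^ 'k ^ 'n) = 0"
  by (simp add: matrix_matrix_mult_def vec_eq_iff)

lemma matrix_mult_zero_right: "(X :: real ^ 'n ^ 'm) ** (0 :: real ^ 'k ^ 'n) = 0"
  by (simp add: matrix_matrix_mult_def vec_eq_iff)

lemma matrix_mult_minus_left: "(- X :: real ^ 'n ^ 'm) ** (Y :: real ^ 'k ^ 'n) = - (X ** Y)"
  by (simp add: matrix_matrix_mult_def vec_eq_iff sum_negf)

lemma matrix_mult_minus_right: "(X :: real ^ 'n ^ 'm) ** (- Y :: real ^ 'k ^ 'n) = - (X ** Y)"
  by (simp add: matrix_matrix_mult_def vec_eq_iff sum_negf)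

lemma matrix_mult_add_distrib_right:
  fixes X Y :: "real ^ 'n ^ 'm" and Z :: "real ^ 'k ^ 'n"
  shows "(X + Y) ** Z = X ** Z + Y ** Z"
  by (simp add: matrix_matrix_mult_def vec_eq_iff distrib_right sum.distrib)

lemma matrix_mult_diff_distrib_left:
  fixes X :: "real ^ 'n ^ 'm" and Y Z :: "real ^ 'k ^ 'n"
  shows "X ** (Y - Z) = X ** Y - X ** Z"
  using matrix_add_ldistrib [of X Y "- Z"] by (simp add: matrix_mult_minus_right)

lemma matrix_mult_diff_distrib_right:
  fixes X Y :: "real ^ 'n ^ 'm" and Z :: "real ^ 'k ^ 'n"
  shows "(X - Y) ** Z = X ** Z - Y ** Z"
  using matrix_mult_add_distrib_right [of X "- Y" Z] by (simp add: matrix_mult_minus_left)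

lemmas block_simps =
  transpose_hcat transpose_vcat hcat_mult_vcat vcat_mult mult_hcat hcat_add vcat_add
  hcat_zero vcat_zero transpose_zero transpose_add matrix_mult_zero_left matrix_mult_zero_right

definition block_diag ::
  "real ^ 'n ^ 'n \<Rightarrow> real ^ 'm ^ 'm \<Rightarrow> real ^ ('n + 'm) ^ ('n + 'm)"
  where "block_diag X Y = (X ||| 0) /// (0 ||| Y)"

lemma block_diag_mult: "block_diag X Y ** block_diag X' Y' = block_diag (X ** X') (Y ** Y')"
  by (simp add: block_diag_def block_simps)

lemma block_diag_mat_1: "block_diag (mat 1) (mat 1) = mat 1"
  by (auto simp: block_diag_def hcat_def vcat_def mat_def vec_eq_iff split: sum.split)

section \<open>Congruence and Schur complements\<close>

lemma psd_matrix_congruence: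
  fixes X :: "real ^ 'n ^ 'n" and T :: "real ^ 'm ^ 'n"
  assumes "psd_matrix X"
  shows "psd_matrix (transpose T ** X ** T)"
  unfolding psd_matrix_def
proof (intro conjI allI)
  show "transpose (transpose T ** X ** T) = transpose T ** X ** T"
    using assms by (simp add: psd_matrix_def matrix_transpose_mul matrix_mul_assoc)
  show "0 \<le> x \<bullet> ((transpose T ** X ** T) *v x)" for x
  proof -
    have "x \<bullet> ((transpose T ** X ** T) *v x) = ((X *v (T *v x)) v* T) \<bullet> x"
      by (simp add: matrix_vector_mul_assoc [symmetric] inner_commute)
    also have "\<dots> = (T *v x) \<bullet> (X *v (T *v x))"
      unfolding dot_lmul_matrix by (rule inner_commute)
    also have "\<dots> \<ge> 0"
      using assms by (simp add: psd_matrix_def)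
    finally show ?thesis .
  qed
qed

lemma psd_matrix_congruence_iff:
  fixes X T :: "real ^ 'n ^ 'n"
  assumes "T ** T' = mat 1"
  shows "psd_matrix (transpose T ** X ** T) \<longleftrightarrow> psd_matrix X"
proof
  assume "psd_matrix (transpose T ** X ** T)"
  then have "psd_matrix (transpose T' ** (transpose T ** X ** T) ** T')"
    by (rule psd_matrix_congruence)
  also have "transpose T' ** (transpose T ** X ** T) ** T' = transpose (T ** T') ** X ** (T ** T')"
    by (simp add: matrix_transpose_mul matrix_mul_assoc)
  finally show "psd_matrix X"
    by (simp add: assms)
qed (rule psd_matrix_congruence)

lemma psd_matrix_add: "psd_matrix X \<Longrightarrow> psd_matrix Y \<Longrightarrow> psd_matrix (X + Y)"
  by (simp add: psd_matrix_def transpose_add matrix_vector_mult_add_rdistrib inner_add_right)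

text \<open>Congruence with the block column \<open>[1; 0]\<close> or \<open>[0; 1]\<close> extracts a diagonal block; congruence
  with the block row \<open>[1, 0]\<close> or \<open>[0, 1]\<close> pads a block with zeros, and the two padded blocks
  add up to the block diagonal matrix.\<close>

lemma psd_matrix_block_diag_iff:
  "psd_matrix (block_diag X Y) \<longleftrightarrow> psd_matrix X \<and> psd_matrix Y"
proof (intro iffI conjI)
  assume *: "psd_matrix (block_diag X Y)"
  show "psd_matrix X"
    using psd_matrix_congruence [OF *, of "mat 1 /// 0"]
    by (simp add: block_diag_def block_simps)
  show "psd_matrix Y"
    using psd_matrix_congruence [OF *, of "0 /// mat 1"]
    by (simp add: block_diag_def block_simps)
next
  assume "psd_matrix X \<and> psd_matrix Y"
  then have "psd_matrix (transpose (mat 1 ||| 0) ** X ** (mat 1 ||| (0 :: real ^ 'b ^ 'a))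
      + transpose (0 ||| mat 1) ** Y ** ((0 :: real ^ 'a ^ 'b) ||| mat 1))"
    by (intro psd_matrix_add psd_matrix_congruence) auto
  then show "psd_matrix (block_diag X Y)"
    by (simp add: block_diag_def vcat_hcat_interchange block_simps)
qed

text \<open>Block elimination: with \<open>L = [[1, 0], [E C, 1]]\<close>, whose inverse is \<open>[[1, 0], [- E C, 1]]\<close>, the
  block matrix equals \<open>L\<^sup>T diag(X - C\<^sup>T E C, D) L\<close>.\<close>

lemma psd_matrix_Schur:
  fixes X :: "real ^ 'n ^ 'n" and C :: "real ^ 'n ^ 'm" and D E :: "real ^ 'm ^ 'm"
  assumes "psd_matrix D" and DE: "D ** E = mat 1"
  shows "psd_matrix ((X ||| transpose C) /// (C ||| D)) \<longleftrightarrow>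
    psd_matrix (X - transpose C ** E ** C)"
proof -
  define L where "L = (mat 1 ||| 0) /// (E ** C ||| mat 1)"
  define L' where "L' = (mat 1 ||| 0) /// (- (E ** C) ||| mat 1)"
  have LL': "L ** L' = mat 1"
    by (simp add: L_def L'_def block_simps block_diag_mat_1 [symmetric] block_diag_def)
  have "transpose D = D"
    using assms(1) by (simp add: psd_matrix_def)
  then have ED: "transpose E ** D = mat 1"
    using DE by (metis matrix_transpose_mul transpose_mat)
  have E: "transpose E = E"
    by (metis DE ED matrix_mul_assoc matrix_mul_lid matrix_mul_rid)
  have CED: "transpose C ** E ** D = transpose C"
    using ED by (simp add: E matrix_mul_assoc [symmetric])
  have "(X ||| transpose C) /// (C ||| D)
      = transpose L ** block_diag (X - transpose C ** E ** C) D ** L"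
    by (simp add: L_def block_simps block_diag_def vcat_hcat_interchange matrix_transpose_mul
        matrix_mul_assoc DE CED E)
  then show ?thesis
    by (simp add: psd_matrix_congruence_iff [OF LL'] psd_matrix_block_diag_iff assms(1))
qed

section \<open>Inverses of positive definite matrices\<close>

lemma pd_matrix_imp_psd_matrix: "pd_matrix X \<Longrightarrow> psd_matrix X"
  unfolding pd_matrix_def psd_matrix_def by (metis inner_zero_left less_imp_le order_refl)

lemma pd_matrix_imp_invertible:
  assumes "pd_matrix X"
  shows "invertible X"
proof -
  have "x = 0" if "X *v x = 0" for x
    using assms that unfolding pd_matrix_def by (metis inner_zero_right less_irrefl)
  then show ?thesis
    by (simp add: invertible_left_inverse matrix_left_invertible_ker)
qed

lemma pd_matrix_mult_matrix_inv:
  assumes "pd_matrix X"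
  shows "X ** matrix_inv X = mat 1" "matrix_inv X ** X = mat 1"
proof -
  have "X ** matrix_inv X = mat 1 \<and> matrix_inv X ** X = mat 1"
    unfolding matrix_inv_def
    by (rule someI_ex) (use pd_matrix_imp_invertible [OF assms] in \<open>simp add: invertible_def\<close>)
  then show "X ** matrix_inv X = mat 1" "matrix_inv X ** X = mat 1"
    by simp_all
qed

text \<open>The inverse is congruent to the matrix itself: by symmetry of \<open>X\<close>,
  \<open>X\<^sup>-\<^sup>1 = (X\<^sup>-\<^sup>1)\<^sup>T X X\<^sup>-\<^sup>1\<close>.\<close>

lemma psd_matrix_matrix_inv:
  assumes "pd_matrix X"
  shows "psd_matrix (matrix_inv X)"
proof -
  let ?I = "matrix_inv X"
  have "transpose ?I ** X = transpose (X ** ?I)"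
    using assms by (simp add: pd_matrix_def matrix_transpose_mul)
  then have "transpose ?I ** X ** ?I = ?I"
    by (simp add: pd_matrix_mult_matrix_inv [OF assms])
  then show ?thesis
    using psd_matrix_congruence [OF pd_matrix_imp_psd_matrix [OF assms], of ?I] by simp
qed

section \<open>The linear matrix inequality\<close>

text \<open>The equivalence for a single triple \<open>(\<alpha>, \<beta>, i)\<close>, with \<open>P = P\<^sub>\<alpha>\<close> and \<open>P' = P\<^sub>\<beta>\<close>: the Schur
  complement of the \<open>4 \<times> 4\<close> block matrix is the congruence of the first matrix by \<open>S = P\<^sup>-\<^sup>1\<close>.\<close>

lemma psd_matrix_closed_loop_iff:
  fixes P P' Q A :: "real ^ 'n ^ 'n" and R :: "real ^ 'm ^ 'm"
    and B :: "real ^ 'm ^ 'n" and K :: "real ^ 'n ^ 'm"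
  assumes P: "pd_matrix P" and P': "pd_matrix P'" and Q: "pd_matrix Q" and R: "pd_matrix R"
    and S: "S = matrix_inv P" and Y: "Y = K ** matrix_inv P"
  shows "psd_matrix
        (P - Q - transpose K ** R ** K
          - transpose A ** P' ** A
          - transpose K ** transpose B ** P' ** B ** K
          - transpose K ** transpose B ** P' ** A
          - transpose A ** P' ** B ** K)
     \<longleftrightarrow> psd_matrix
        (S ||| S ** transpose A + transpose Y ** transpose B ||| S ||| transpose Y ///
         A ** S + B ** Y ||| matrix_inv P' ||| 0 ||| 0 ///
         S ||| 0 ||| matrix_inv Q ||| 0 ///
         Y ||| 0 ||| 0 ||| matrix_inv R)"
    (is "psd_matrix ?W \<longleftrightarrow> psd_matrix ?Z")
proof -
  define C where "C = (A ** S + B ** Y) /// S /// Y"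
  define D where "D = block_diag (matrix_inv P') (block_diag (matrix_inv Q) (matrix_inv R))"
  define E where "E = block_diag P' (block_diag Q R)"
  have SP: "S ** P = mat 1"
    using pd_matrix_mult_matrix_inv(2) [OF P] by (simp add: S)
  have tS: "transpose S = S"
    using psd_matrix_matrix_inv [OF P] by (simp add: S psd_matrix_def)
  have Y': "Y = K ** S"
    by (simp add: S Y)
  have psdD: "psd_matrix D"
    by (simp add: D_def psd_matrix_block_diag_iff psd_matrix_matrix_inv P' Q R)
  have DE: "D ** E = mat 1"
    by (simp add: D_def E_def block_diag_mult pd_matrix_mult_matrix_inv P' Q R block_diag_mat_1)
  have Z: "?Z = (S ||| transpose C) /// (C ||| D)"
  proof -
    have "transpose C = S ** transpose A + transpose Y ** transpose B ||| S ||| transpose Y"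
      by (simp add: C_def block_simps matrix_transpose_mul tS)
    moreover have "C ||| D = (A ** S + B ** Y ||| matrix_inv P' ||| 0 ||| 0) ///
         (S ||| 0 ||| matrix_inv Q ||| 0) /// (Y ||| 0 ||| 0 ||| matrix_inv R)"
      by (simp add: C_def D_def block_diag_def vcat_hcat_interchange block_simps)
    ultimately show ?thesis
      by simp
  qed
  \<comment> \<open>\<open>S P S = S\<close> turns the leading \<open>S\<close> into the \<open>P\<close> term of the congruence.\<close>
  have "S - transpose C ** E ** C = transpose S ** ?W ** S"
  proof -
    have "transpose C ** E ** C = transpose (A ** S + B ** Y) ** P' ** (A ** S + B ** Y)
        + (S ** Q ** S + transpose Y ** R ** Y)"
      by (simp add: C_def E_def block_diag_def block_simps tS)
    also have "\<dots> = S ** transpose A ** P' ** A ** S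
        + S ** transpose A ** P' ** B ** K ** S
        + S ** transpose K ** transpose B ** P' ** A ** S
        + S ** transpose K ** transpose B ** P' ** B ** K ** S
        + S ** Q ** S + S ** transpose K ** R ** K ** S"
      by (simp add: Y' transpose_add matrix_transpose_mul tS matrix_add_ldistrib
          matrix_mult_add_distrib_right matrix_mul_assoc add_ac)
    finally show ?thesis
      by (simp add: tS matrix_mult_diff_distrib_left matrix_mult_diff_distrib_right
          matrix_add_ldistrib matrix_mult_add_distrib_right matrix_mul_assoc SP diff_diff_eq add_ac)
  qed
  then have "psd_matrix ?Z \<longleftrightarrow> psd_matrix (transpose S ** ?W ** S)"
    by (simp add: Z psd_matrix_Schur [OF psdD DE])
  then show ?thesis
    using psd_matrix_congruence_iff [OF SP] by blast
qed

theorem proposition7: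
  fixes M :: nat
    and \<S> :: "'s set"
    and \<E> :: "('s \<times> 's \<times> nat) set"
    and A :: "nat \<Rightarrow> real ^ 'n ^ 'n"
    and B :: "nat \<Rightarrow> real ^ 'm ^ 'n"
    and K :: "'s \<Rightarrow> real ^ 'n ^ 'm"
    and P S :: "'s \<Rightarrow> real ^ 'n ^ 'n"
    and Y :: "'s \<Rightarrow> real ^ 'n ^ 'm"
    and Q :: "real ^ 'n ^ 'n"
    and R :: "real ^ 'm ^ 'm"
  assumes "M \<ge> 1"
    and "finite \<S>"
    and "\<E> \<subseteq> \<S> \<times> \<S> \<times> {1..M}"
    and "\<And>\<alpha>. \<alpha> \<in> \<S> \<Longrightarrow> pd_matrix (P \<alpha>)"
    and "pd_matrix Q"
    and "pd_matrix R"
    and "\<And>\<alpha>. \<alpha> \<in> \<S> \<Longrightarrow> S \<alpha> = matrix_inv (P \<alpha>)"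
    and "\<And>\<alpha>. \<alpha> \<in> \<S> \<Longrightarrow> Y \<alpha> = K \<alpha> ** matrix_inv (P \<alpha>)"
  shows
    "(\<forall>(\<alpha>, \<beta>, i) \<in> \<E>. psd_matrix
        (P \<alpha> - Q - transpose (K \<alpha>) ** R ** K \<alpha>
          - transpose (A i) ** P \<beta> ** A i
          - transpose (K \<alpha>) ** transpose (B i) ** P \<beta> ** B i ** K \<alpha>
          - transpose (K \<alpha>) ** transpose (B i) ** P \<beta> ** A i
          - transpose (A i) ** P \<beta> ** B i ** K \<alpha>))
     \<longleftrightarrow>
     (\<forall>(\<alpha>, \<beta>, i) \<in> \<E>. psd_matrix
        (S \<alpha> ||| S \<alpha> ** transpose (A i) + transpose (Y \<alpha>) ** transpose (B i) ||| S \<alpha> ||| transpose (Y \<alpha>) ///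
         A i ** S \<alpha> + B i ** Y \<alpha> ||| S \<beta> ||| 0 ||| 0 ///
         S \<alpha> ||| 0 ||| matrix_inv Q ||| 0 ///
         Y \<alpha> ||| 0 ||| 0 ||| matrix_inv R))"
proof (rule ball_cong [OF refl], clarify)
  fix \<alpha> \<beta> i
  assume "(\<alpha>, \<beta>, i) \<in> \<E>"
  then have \<alpha>: "\<alpha> \<in> \<S>" and \<beta>: "\<beta> \<in> \<S>"
    using assms(3) by auto
  show "psd_matrix
        (P \<alpha> - Q - transpose (K \<alpha>) ** R ** K \<alpha>
          - transpose (A i) ** P \<beta> ** A i
          - transpose (K \<alpha>) ** transpose (B i) ** P \<beta> ** B i ** K \<alpha>
          - transpose (K \<alpha>) ** transpose (B i) ** P \<beta> ** A i
          - transpose (A i) ** P \<beta> ** B i ** K \<alpha>)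
     \<longleftrightarrow> psd_matrix
        (S \<alpha> ||| S \<alpha> ** transpose (A i) + transpose (Y \<alpha>) ** transpose (B i) ||| S \<alpha> ||| transpose (Y \<alpha>) ///
         A i ** S \<alpha> + B i ** Y \<alpha> ||| S \<beta> ||| 0 ||| 0 ///
         S \<alpha> ||| 0 ||| matrix_inv Q ||| 0 ///
         Y \<alpha> ||| 0 ||| 0 ||| matrix_inv R)"
    unfolding assms(7) [OF \<beta>]
    by (rule psd_matrix_closed_loop_iff)
      (simp_all add: \<alpha> \<beta> assms)
qed

end
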